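(* Suppose that $u_i\neq0$ for all $i=1,\ldots,k$. For any $\theta\in\mathring{\Theta}$ and for any choice of $(u_1,\ldots,u_k)\in\mathbb{R}^k$ such that $|u_i|\neq|u_j|$ for $i\neq j$: (i) the rows of $\gamma_\theta(\theta)$ are linearly independent for $k\ge2$, namely $\mathrm{rank}(\gamma_\theta(\theta))=4$; (ii) $\Sigma(\theta)$ is positive definite.
   Context: Stable law. The parameter is $\theta=(\mu,\sigma,\alpha,\beta)^\top\in\Theta=\mathbb{R}\times(0,\infty)\times(0,2]\times[-1,1]$, and $\mathring{\Theta}=\mathbb{R}\times(0,\infty)\times(0,2)\times(-1,1)$ is the interior. The stable distribution with parameter $\theta$ has characteristic function \[ \varphi(u;\theta)=\exp\Big(-|\sigma u|^\alpha\big\{1+i\beta\,\mathrm{sign}(u)\tan\tfrac{\pi\alpha}{2}\,(|\sigma u|^{1-\alpha}-1)\big\}+i\mu u\Big)\quad(\alpha\neq1), \] \[ \varphi(u;\theta)=\exp\Big(-|\sigma u|-i\sigma u\,(2\beta/\pi)\log|\sigma u|+i\mu u\Big)\quad(\alpha=1) \] (this is a continuous parametrization, also across $\alpha=1$), and $f(x;\theta)$ denotes its density. $\mathbb{E}_\theta$ is expectation when $X$ has density $f(\cdot;\theta)$. Write $\varphi^R,\varphi^I$ for the real and imaginary parts of $\varphi$. A subscript $\theta$ on a function denotes its vector of partial derivatives with respect to the four components of $\theta$ (a column). For points $u_1,\ldots,u_k$ put \[ g(x)=(\cos(u_1x),\ldots,\cos(u_kx),\sin(u_1x),\ldots,\sin(u_kx))^\top,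 \] \[ \gamma(\theta)=\mathbb{E}_\theta[g(X)]=(\varphi^R(u_1;\theta),\ldots,\varphi^R(u_k;\theta),\varphi^I(u_1;\theta),\ldots,\varphi^I(u_k;\theta))^\top, \] \[ \gamma_\theta(\theta)=(\varphi^R_\theta(u_1;\theta),\ldots,\varphi^R_\theta(u_k;\theta),\varphi^I_\theta(u_1;\theta),\ldots,\varphi^I_\theta(u_k;\theta))\quad(4\times 2k\text{ matrix}), \] \[ \Sigma(\theta)=\mathbb{E}_\theta[(g(X)-\gamma(\theta))(g(X)-\gamma(\theta))^\top]\quad(2k\times2k\text{ matrix}). \] *)

theory Defs
  imports "HOL-Probability.Probability"
begin

text \<open>
  A parameter \<open>\<theta> = (\<mu>, \<sigma>, \<alpha>, \<beta>)\<close> is a vector in \<open>real ^ 4\<close>, read off as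
  \<open>\<theta>$1, \<theta>$2, \<theta>$3, \<theta>$4\<close>.  The evaluation points \<open>u\<^sub>1, \<dots>, u\<^sub>k\<close> are a vector
  \<open>u :: real ^ 'k\<close> with \<open>k = CARD('k)\<close>.  The \<open>2k\<close> coordinates of \<open>g\<close> and \<open>\<gamma>\<close> are
  indexed by \<open>'k + 'k\<close>: \<open>Inl i\<close> is the cosine (real part) coordinate at \<open>u\<^sub>i\<close>,
  \<open>Inr i\<close> the sine (imaginary part) coordinate.
\<close>

definition stable_params_int :: "(real ^ 4) set" where
  "stable_params_int = {\<theta>. 0 < \<theta>$2 \<and> 0 < \<theta>$3 \<and> \<theta>$3 < 2 \<and> -1 < \<theta>$4 \<and> \<theta>$4 < 1}"

text \<open>
  At \<open>u = 0\<close> the conventions \<open>0 powr a = 0\<close> and \<open>ln 0 = 0\<close> give the intended value \<open>1\<close>.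
\<close>

definition stable_cf :: "real ^ 4 \<Rightarrow> real \<Rightarrow> complex" where
  "stable_cf \<theta> u =
    (let \<mu> = \<theta>$1; \<sigma> = \<theta>$2; \<alpha> = \<theta>$3; \<beta> = \<theta>$4 in
     if \<alpha> \<noteq> 1 then
       exp (- complex_of_real (\<bar>\<sigma> * u\<bar> powr \<alpha>)
              * (1 + \<i> * complex_of_real
                   (\<beta> * sgn u * tan (pi * \<alpha> / 2) * (\<bar>\<sigma> * u\<bar> powr (1 - \<alpha>) - 1)))
            + \<i> * complex_of_real (\<mu> * u))
     else
       exp (- complex_of_real \<bar>\<sigma> * u\<bar>
            - \<i> * complex_of_real (\<sigma> * u * (2 * \<beta> / pi) * ln \<bar>\<sigma> * u\<bar>)
            + \<i> * complex_of_real (\<mu> * u)))"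

text \<open>
  \<open>P\<close> is the stable distribution with parameter \<open>\<theta>\<close>, i.e. the Borel probability measure
  with characteristic function \<open>stable_cf \<theta>\<close>; it is unique by \<open>Levy_uniqueness\<close>.
  Expectation under \<open>\<theta>\<close> is integration with respect to \<open>P\<close>; if \<open>f\<close> is the stable density,
  then \<open>P = density lborel f\<close>.
\<close>

definition stable_law :: "real ^ 4 \<Rightarrow> real measure \<Rightarrow> bool" where
  "stable_law \<theta> P \<longleftrightarrow> real_distribution P \<and> char P = stable_cf \<theta>"

definition trig_vec :: "real ^ 'k \<Rightarrow> real \<Rightarrow> real ^ ('k::finite + 'k)" where
  "trig_vec u x = (\<chi> c. case c of Inl i \<Rightarrow> cos (u$i * x) | Inr i \<Rightarrow> sin (u$i * x))"

definition gamma_vec :: "real ^ 'k \<Rightarrow> real ^ 4 \<Rightarrow> real ^ ('k::finite + 'k)" where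
  "gamma_vec u \<theta> =
    (\<chi> c. case c of Inl i \<Rightarrow> Re (stable_cf \<theta> (u$i)) | Inr i \<Rightarrow> Im (stable_cf \<theta> (u$i)))"

definition partial_deriv :: "(real ^ 'n \<Rightarrow> real) \<Rightarrow> 'n \<Rightarrow> real ^ 'n::finite \<Rightarrow> real" where
  "partial_deriv F j \<theta> = deriv (\<lambda>t. F (\<theta> + t *\<^sub>R axis j 1)) 0"

definition gamma_theta :: "real ^ 'k \<Rightarrow> real ^ 4 \<Rightarrow> real ^ ('k::finite + 'k) ^ 4" where
  "gamma_theta u \<theta> = (\<chi> j c. partial_deriv (\<lambda>\<eta>. gamma_vec u \<eta> $ c) j \<theta>)"

definition Sigma_mat ::
    "real measure \<Rightarrow> real ^ 'k \<Rightarrow> real ^ 4 \<Rightarrow> real ^ ('k::finite + 'k) ^ ('k + 'k)" where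
  "Sigma_mat P u \<theta> =
    (\<chi> c d. \<integral>x. (trig_vec u x $ c - gamma_vec u \<theta> $ c)
                * (trig_vec u x $ d - gamma_vec u \<theta> $ d) \<partial>P)"

definition positive_definite :: "real ^ 'n ^ 'n::finite \<Rightarrow> bool" where
  "positive_definite A \<longleftrightarrow> transpose A = A \<and> (\<forall>x. x \<noteq> 0 \<longrightarrow> x \<bullet> (A *v x) > 0)"

lemma gamma_vec_eq_expectation:
  fixes u :: "real ^ 'k::finite"
  assumes "stable_law \<theta> P"
  shows "gamma_vec u \<theta> = (\<chi> c. \<integral>x. trig_vec u x $ c \<partial>P)"
proof -
  interpret real_distribution P using assms by (simp add: stable_law_def)
  have ch: "stable_cf \<theta> t = (CLINT x|P. iexp (t * x))" for t
    using assms unfolding stable_law_def char_def by metis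
  have int: "integrable P (\<lambda>x. iexp (t * x))" for t
    by (intro integrable_const_bound[where B = 1]) auto
  have "Re (stable_cf \<theta> t) = (\<integral>x. cos (t * x) \<partial>P)" for t
    unfolding ch integral_Re[OF int, symmetric] by (simp add: Re_exp)
  moreover have "Im (stable_cf \<theta> t) = (\<integral>x. sin (t * x) \<partial>P)" for t
    unfolding ch integral_Im[OF int, symmetric] by (simp add: Im_exp)
  ultimately show ?thesis
    by (auto simp: gamma_vec_def trig_vec_def vec_eq_iff split: sum.splits)
qed

end

theory Submission
  imports Defs "HOL-Complex_Analysis.Cauchy_Integral_Formula" "HOL-Real_Asymp.Real_Asymp"
begin

text \<open>
  For \<open>u \<noteq> 0\<close> and \<open>r = \<sigma> * \<bar>u\<bar>\<close> the characteristic function has the polar form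
  \<open>exp (- A) * cis B\<close> with \<open>A = r powr \<alpha>\<close> and \<open>B = \<mu> * u - \<beta> * \<sigma> * u * skew \<alpha> r\<close>, where
  \<open>skew\<close> covers both formulas of the parametrization (\<open>stable_cf_polar\<close>).

  Linear independence of the rows.  A vanishing combination \<open>y\<close> of the partial derivatives of
  \<open>exp (- A) * cis B\<close> is a vanishing combination of those of \<open>A\<close> and of those of \<open>B\<close>, because
  the factor \<open>exp (- A) * cis B\<close> is not zero (\<open>score_dependency_splits\<close>).  The condition on \<open>A\<close>
  reads \<open>y\<^sub>2 * \<alpha> / \<sigma> + y\<^sub>3 * ln r = 0\<close>; two different radii \<open>r\<close> give \<open>y\<^sub>3 = 0\<close> and then \<open>y\<^sub>2 = 0\<close>.
  What remains of the condition on \<open>B\<close> is \<open>y\<^sub>1 = y\<^sub>4 * \<sigma> * skew \<alpha> r\<close>; as \<open>skew \<alpha>\<close> is injective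
  (\<open>skew_inj\<close>), two radii give \<open>y\<^sub>4 = 0\<close> and then \<open>y\<^sub>1 = 0\<close> (\<open>stable_score_independent\<close>).
  The derivatives of \<open>B\<close> in \<open>\<sigma>\<close> and \<open>\<alpha>\<close> enter only through their existence, which is delicate
  at \<open>\<alpha> = 1\<close>, where \<open>skew\<close> has a removable singularity (\<open>skew_differentiable_index\<close>).

  Positive definiteness.  The quadratic form of \<open>\<Sigma>\<close> at \<open>x\<close> is the second moment of
  \<open>x \<bullet> (g X - \<gamma>)\<close>, so it can vanish only if a real trigonometric polynomial with frequencies
  \<open>0\<close> and \<open>\<plusminus>u\<^sub>i\<close> is zero almost surely.  Multiplying such a polynomial \<open>\<Sum>\<^sub>v c\<^sub>v * iexp (v * X)\<close>
  by \<open>iexp (t * X)\<close> and integrating yields \<open>\<Sum>\<^sub>v c\<^sub>v * \<phi> (t + v) = 0\<close> for all \<open>t\<close>.  Now \<open>\<phi>\<close> is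
  analytic off the origin, but at the origin it is not even twice differentiable as
  \<open>\<alpha> < 2\<close>.  Near \<open>t = - v\<close> exactly one term of the identity is singular, which forces
  \<open>c\<^sub>v = 0\<close>.  Smoothness is measured by symmetric second differences
  (\<open>stable_cf_second_diff_away_from_0\<close>, \<open>stable_cf_second_diff_at_0\<close>, \<open>exp_independent_AE\<close>).
\<close>

section \<open>Polar form of the characteristic function\<close>

text \<open>
  The value at \<open>a = 1\<close> is the limit of the other branch.  In these terms the two formulas for the
  stable characteristic function become one.
\<close>
definition skew :: "real \<Rightarrow> real \<Rightarrow> real" where
  "skew a r = (if a = 1 then 2 / pi * ln r else tan (pi * a / 2) * (1 - r powr (a - 1)))"

lemma stable_cf_polar:
  assumes "u \<noteq> 0" "\<theta>$2 > 0"
  shows "stable_cf \<theta> u = exp (- of_real ((\<theta>$2 * \<bar>u\<bar>) powr \<theta>$3)) *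
     cis (\<theta>$1 * u - \<theta>$4 * (\<theta>$2 * u) * skew (\<theta>$3) (\<theta>$2 * \<bar>u\<bar>))"
proof -
  define r where "r = \<theta>$2 * \<bar>u\<bar>"
  have r: "r > 0" and u: "\<theta>$2 * u = sgn u * r" and abs: "\<bar>\<theta>$2 * u\<bar> = r"
    using assms by (auto simp: r_def sgn_if abs_mult)
  let ?z = "Complex (- (r powr \<theta>$3)) (\<theta>$1 * u - \<theta>$4 * (\<theta>$2 * u) * skew (\<theta>$3) r)"
  have "stable_cf \<theta> u = exp ?z"
  proof (cases "\<theta>$3 = 1")
    case True
    have "- complex_of_real r - \<i> * complex_of_real (\<theta>$2 * u * (2 * \<theta>$4 / pi) * ln r)
        + \<i> * complex_of_real (\<theta>$1 * u) = ?z"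
      using True r by (simp add: complex_eq_iff skew_def)
    then show ?thesis using True by (simp add: stable_cf_def Let_def abs)
  next
    case False
    have e: "r powr \<theta>$3 * (r powr (1 - \<theta>$3) - 1) = r * (1 - r powr (\<theta>$3 - 1))"
      using r by (simp add: right_diff_distrib powr_diff)
    have "r powr \<theta>$3 * (\<theta>$4 * sgn u * tan (pi * \<theta>$3 / 2) * (r powr (1 - \<theta>$3) - 1))
       = \<theta>$4 * (sgn u * r) * (tan (pi * \<theta>$3 / 2) * (1 - r powr (\<theta>$3 - 1)))"
      using e by algebra
    then have "- complex_of_real (r powr \<theta>$3) * (1 + \<i> * complex_of_real
         (\<theta>$4 * sgn u * tan (pi * \<theta>$3 / 2) * (r powr (1 - \<theta>$3) - 1)))
        + \<i> * complex_of_real (\<theta>$1 * u) = ?z"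
      using False by (simp add: complex_eq_iff skew_def u)
    then show ?thesis using False by (simp add: stable_cf_def Let_def abs)
  qed
  also have "\<dots> = exp (- of_real (r powr \<theta>$3)) * cis (\<theta>$1 * u - \<theta>$4 * (\<theta>$2 * u) * skew (\<theta>$3) r)"
    by (simp add: exp_eq_polar exp_of_real flip: of_real_minus)
  finally show ?thesis by (simp add: r_def)
qed

text \<open>
  For \<open>a \<noteq> 1\<close> the factor \<open>tan (pi * a / 2)\<close> is neither zero nor a default value, since
  \<open>pi * a / 2\<close> lies in the open interval from \<open>0\<close> to \<open>pi\<close> and differs from \<open>pi / 2\<close>.
\<close>

lemma skew_inj:
  assumes "0 < a" "a < 2" "0 < r" "0 < s" "skew a r = skew a s"
  shows "r = s"
proof (cases "a = 1")
  case True
  with assms show ?thesis by (simp add: skew_def)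
next
  case False
  have "sin (pi * a / 2) > 0"
    using assms by (intro sin_gt_zero) auto
  moreover have "cos (pi * a / 2) \<noteq> cos (pi / 2)"
    using assms False cos_inj_pi[of "pi * a / 2" "pi / 2"] by auto
  ultimately have "tan (pi * a / 2) \<noteq> 0"
    by (simp add: tan_def)
  with assms False have "r powr (a - 1) = s powr (a - 1)"
    by (simp add: skew_def)
  then have "(a - 1) * ln r = (a - 1) * ln s"
    using assms by (metis ln_powr)
  with False assms show ?thesis by simp
qed

lemma skew_differentiable_radius:
  assumes "r > 0"
  shows "\<exists>D. (skew a has_real_derivative D) (at r)"
proof (cases "a = 1")
  case True
  have "((\<lambda>r. 2 / pi * ln r) has_real_derivative 2 / pi * (1 / r)) (at r)"
    using assms by (auto intro!: derivative_eq_intros)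
  with True show ?thesis by (auto simp: skew_def [abs_def])
next
  case False
  have "((\<lambda>r. tan (pi * a / 2) * (1 - r powr (a - 1))) has_real_derivative
      tan (pi * a / 2) * (- ((a - 1) * r powr (a - 1 - 1)))) (at r)"
    using assms by (auto intro!: derivative_eq_intros)
  with False show ?thesis by (auto simp: skew_def [abs_def])
qed

text \<open>
  The expression under the limit is the difference quotient at \<open>a = 1\<close> of \<open>\<lambda>a. skew a r\<close> with
  \<open>h = a - 1\<close> and \<open>L = ln r\<close>.  Since \<open>cot (pi * h / 2)\<close> is \<open>2 / (pi * h)\<close> up to \<open>O(h)\<close>, the
  limit is \<open>2 / pi\<close> times the quadratic Taylor coefficient \<open>L\<^sup>2 / 2\<close> of \<open>exp (h * L)\<close>.
\<close>

lemma cot_exp_quotient_tendsto: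
  fixes L :: real
  shows "((\<lambda>h. (cos (pi * h / 2) / sin (pi * h / 2) * (exp (h * L) - 1) - 2 / pi * L) / h)
    \<longlongrightarrow> L\<^sup>2 / pi) (at 0)"
proof -
  consider "L > 0" | "L < 0" | "L = 0" by linarith
  then show ?thesis
    by cases (real_asymp simp: power2_eq_square field_simps)+
qed

lemma skew_differentiable_index:
  assumes "0 < a" "a < 2" "r > 0"
  shows "\<exists>D. ((\<lambda>a. skew a r) has_real_derivative D) (at a)"
proof (cases "a = 1")
  case True
  have eq: "(skew (1 + h) r - skew 1 r) / h =
      (cos (pi*h/2) / sin (pi*h/2) * (exp (h * ln r) - 1) - 2/pi * ln r) / h" if "h \<noteq> 0" for h
  proof -
    have e: "pi * (1 + h) / 2 = pi * h / 2 + pi / 2" by (simp add: field_simps)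
    have "tan (pi * (1 + h) / 2) = - (cos (pi*h/2) / sin (pi*h/2))"
      unfolding tan_def e sin_add cos_add by simp
    moreover have "r powr h = exp (h * ln r)"
      using assms by (simp add: powr_def)
    ultimately show ?thesis using that by (simp add: skew_def algebra_simps diff_divide_distrib)
  qed
  have "((\<lambda>h. (skew (1 + h) r - skew 1 r) / h) \<longlongrightarrow> (ln r)\<^sup>2 / pi) (at 0)"
    using cot_exp_quotient_tendsto[of "ln r"] 
    by (rule Lim_transform_eventually, unfold eventually_at_filter)
      (intro always_eventually allI impI eq[symmetric])
  then show ?thesis using True by (auto simp: DERIV_def)
next
  case False
  have "cos (pi * a / 2) \<noteq> cos (pi / 2)"
    using assms False cos_inj_pi[of "pi * a / 2" "pi / 2"] by auto
  then have c: "cos (pi * a / 2) \<noteq> 0" by simp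
  have "((\<lambda>a. tan (pi * a / 2)) has_real_derivative inverse ((cos (pi * a / 2))\<^sup>2) * (pi / 2)) (at a)"
    by (rule DERIV_chain2[where g = "\<lambda>a. pi * a / 2", OF DERIV_tan[OF c]]) (auto intro!: derivative_eq_intros)
  moreover have "((\<lambda>a. 1 - r powr (a - 1)) has_real_derivative - (r powr (a - 1) * ln r)) (at a)"
    using assms by (auto intro!: derivative_eq_intros)
  ultimately obtain D where "((\<lambda>a. tan (pi * a / 2) * (1 - r powr (a - 1))) has_real_derivative D) (at a)"
    using DERIV_mult by blast
  then have "((\<lambda>a. skew a r) has_real_derivative D) (at a)"
    by (rule has_field_derivative_transform_within_open[where S = "-{1}"])
      (use False in \<open>auto simp: skew_def\<close>)
  then show ?thesis ..
qed

section \<open>Partial derivatives\<close>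

definition decay_exp :: "real \<Rightarrow> real ^ 4 \<Rightarrow> real" where
  "decay_exp u \<theta> = (\<theta>$2 * \<bar>u\<bar>) powr \<theta>$3"

definition phase :: "real \<Rightarrow> real ^ 4 \<Rightarrow> real" where
  "phase u \<theta> = \<theta>$1 * u - \<theta>$4 * (\<theta>$2 * u) * skew (\<theta>$3) (\<theta>$2 * \<bar>u\<bar>)"

lemma axis_nths:
  "axis (1::4) (1::real) $ 1 = 1" "axis (1::4) (1::real) $ 2 = 0" "axis (1::4) (1::real) $ 3 = 0" "axis (1::4) (1::real) $ 4 = 0"
  "axis (2::4) (1::real) $ 1 = 0" "axis (2::4) (1::real) $ 2 = 1" "axis (2::4) (1::real) $ 3 = 0" "axis (2::4) (1::real) $ 4 = 0"
  "axis (3::4) (1::real) $ 1 = 0" "axis (3::4) (1::real) $ 2 = 0" "axis (3::4) (1::real) $ 3 = 1" "axis (3::4) (1::real) $ 4 = 0"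
  "axis (4::4) (1::real) $ 1 = 0" "axis (4::4) (1::real) $ 2 = 0" "axis (4::4) (1::real) $ 3 = 0" "axis (4::4) (1::real) $ 4 = 1"
  by (simp_all add: axis_def)

lemma decay_exp_partials:
  assumes "\<theta> \<in> stable_params_int" "u \<noteq> 0"
  defines "r \<equiv> \<theta>$2 * \<bar>u\<bar>"
  shows
    "((\<lambda>t. decay_exp u (\<theta> + t *\<^sub>R axis 1 1)) has_real_derivative 0) (at 0)"
    "((\<lambda>t. decay_exp u (\<theta> + t *\<^sub>R axis 2 1)) has_real_derivative r powr \<theta>$3 * (\<theta>$3 / \<theta>$2)) (at 0)"
    "((\<lambda>t. decay_exp u (\<theta> + t *\<^sub>R axis 3 1)) has_real_derivative r powr \<theta>$3 * ln r) (at 0)"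
    "((\<lambda>t. decay_exp u (\<theta> + t *\<^sub>R axis 4 1)) has_real_derivative 0) (at 0)"
proof -
  have pos: "\<theta>$2 > 0" "r > 0" "\<theta>$3 > 0" using assms by (auto simp: stable_params_int_def)
  show "((\<lambda>t. decay_exp u (\<theta> + t *\<^sub>R axis 1 1)) has_real_derivative 0) (at 0)"
    "((\<lambda>t. decay_exp u (\<theta> + t *\<^sub>R axis 4 1)) has_real_derivative 0) (at 0)"
    by (simp_all add: decay_exp_def axis_nths)
  have "((\<lambda>t. ((\<theta>$2 + t) * \<bar>u\<bar>) powr \<theta>$3) has_real_derivative \<theta>$3 * r powr (\<theta>$3 - 1) * \<bar>u\<bar>) (at 0)"
    using pos assms(2) by (auto intro!: derivative_eq_intros simp: r_def)
  moreover have "\<theta>$3 * r powr (\<theta>$3 - 1) * \<bar>u\<bar> = r powr \<theta>$3 * (\<theta>$3 / \<theta>$2)"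
    using pos by (simp add: powr_diff) (simp add: r_def)
  ultimately show "((\<lambda>t. decay_exp u (\<theta> + t *\<^sub>R axis 2 1)) has_real_derivative r powr \<theta>$3 * (\<theta>$3 / \<theta>$2)) (at 0)"
    by (simp add: decay_exp_def axis_nths)
  show "((\<lambda>t. decay_exp u (\<theta> + t *\<^sub>R axis 3 1)) has_real_derivative r powr \<theta>$3 * ln r) (at 0)"
    unfolding decay_exp_def using pos
    by (auto intro!: derivative_eq_intros simp: axis_nths r_def[symmetric])
qed

text \<open>
  For \<open>\<sigma>\<close> and \<open>\<alpha>\<close> the existence of the derivative suffices: when the phase is considered,
  the decay exponent has already shown that the coefficients of these two derivatives vanish.
\<close>

lemma phase_partials:
  assumes "\<theta> \<in> stable_params_int" "u \<noteq> 0"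
  defines "r \<equiv> \<theta>$2 * \<bar>u\<bar>"
  shows
    "((\<lambda>t. phase u (\<theta> + t *\<^sub>R axis 1 1)) has_real_derivative u) (at 0)"
    "\<exists>D. ((\<lambda>t. phase u (\<theta> + t *\<^sub>R axis 2 1)) has_real_derivative D) (at 0)"
    "\<exists>D. ((\<lambda>t. phase u (\<theta> + t *\<^sub>R axis 3 1)) has_real_derivative D) (at 0)"
    "((\<lambda>t. phase u (\<theta> + t *\<^sub>R axis 4 1)) has_real_derivative - (\<theta>$2 * u * skew (\<theta>$3) r)) (at 0)"
proof -
  have pos: "\<theta>$2 > 0" "r > 0" "\<theta>$3 > 0" "\<theta>$3 < 2" using assms by (auto simp: stable_params_int_def)
  show "((\<lambda>t. phase u (\<theta> + t *\<^sub>R axis 1 1)) has_real_derivative u) (at 0)"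
    unfolding phase_def by (auto intro!: derivative_eq_intros simp: axis_nths)
  show "((\<lambda>t. phase u (\<theta> + t *\<^sub>R axis 4 1)) has_real_derivative - (\<theta>$2 * u * skew (\<theta>$3) r)) (at 0)"
    unfolding phase_def by (auto intro!: derivative_eq_intros simp: axis_nths r_def)
  obtain D where D: "(skew (\<theta>$3) has_real_derivative D) (at ((\<theta>$2 + 0) * \<bar>u\<bar>))"
    using skew_differentiable_radius pos by (force simp: r_def)
  have "((\<lambda>t. skew (\<theta>$3) ((\<theta>$2 + t) * \<bar>u\<bar>)) has_real_derivative D * \<bar>u\<bar>) (at 0)"
    by (rule DERIV_chain2[where g = "\<lambda>t. (\<theta>$2 + t) * \<bar>u\<bar>", OF D]) (auto intro!: derivative_eq_intros)
  from DERIV_mult[OF _ this, of "\<lambda>t. \<theta>$4 * ((\<theta>$2 + t) * u)" "\<theta>$4 * u"]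
  obtain D' where "((\<lambda>t. \<theta>$4 * ((\<theta>$2 + t) * u) * skew (\<theta>$3) ((\<theta>$2 + t) * \<bar>u\<bar>)) has_real_derivative D') (at 0)"
    by (force intro!: derivative_eq_intros)
  from DERIV_diff[OF DERIV_const this, of "\<theta>$1 * u"]
  show "\<exists>D. ((\<lambda>t. phase u (\<theta> + t *\<^sub>R axis 2 1)) has_real_derivative D) (at 0)"
    by (auto simp: phase_def axis_nths)
  obtain E where E: "((\<lambda>a. skew a r) has_real_derivative E) (at (\<theta>$3 + 0))"
    using skew_differentiable_index pos by force
  have "((\<lambda>t. skew (\<theta>$3 + t) r) has_real_derivative E * 1) (at 0)"
    by (rule DERIV_chain2[where g = "\<lambda>t. \<theta>$3 + t", OF E]) (auto intro!: derivative_eq_intros)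
  from DERIV_diff[OF DERIV_const DERIV_cmult[OF this], of "\<theta>$1 * u" "\<theta>$4 * (\<theta>$2 * u)"]
  show "\<exists>D. ((\<lambda>t. phase u (\<theta> + t *\<^sub>R axis 3 1)) has_real_derivative D) (at 0)"
    by (auto simp: phase_def axis_nths r_def)
qed

lemma partial_deriv_eqI:
  "((\<lambda>t. F (\<theta> + t *\<^sub>R axis j 1)) has_real_derivative D) (at 0) \<Longrightarrow> partial_deriv F j \<theta> = D"
  unfolding partial_deriv_def by (rule DERIV_imp_deriv)

text \<open>
  These are the real and imaginary parts of \<open>exp (- A) * cis B * (- A' + \<i> * B')\<close>.
\<close>

lemma partial_deriv_stable_cf:
  fixes j :: 4
  assumes "\<theta> \<in> stable_params_int" "u \<noteq> 0"
  defines "\<rho> \<equiv> exp (- decay_exp u \<theta>)" and "B \<equiv> phase u \<theta>"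
  defines "A' \<equiv> partial_deriv (decay_exp u) j \<theta>" and "B' \<equiv> partial_deriv (phase u) j \<theta>"
  shows "partial_deriv (\<lambda>\<eta>. Re (stable_cf \<eta> u)) j \<theta> = - \<rho> * (cos B * A' + sin B * B')"
    and "partial_deriv (\<lambda>\<eta>. Im (stable_cf \<eta> u)) j \<theta> = \<rho> * (cos B * B' - sin B * A')"
proof -
  let ?c = "\<lambda>t. \<theta> + t *\<^sub>R axis j 1"
  have "\<exists>D. ((\<lambda>t. decay_exp u (?c t)) has_real_derivative D) (at 0)"
    "\<exists>D. ((\<lambda>t. phase u (?c t)) has_real_derivative D) (at 0)"
    using decay_exp_partials[OF assms(1,2)] phase_partials[OF assms(1,2)] exhaust_4[of j] by auto
  then have d: "((\<lambda>t. decay_exp u (?c t)) has_real_derivative A') (at 0)"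
    "((\<lambda>t. phase u (?c t)) has_real_derivative B') (at 0)"
    unfolding A'_def B'_def by (metis partial_deriv_eqI)+
  \<comment> \<open>The polar form needs a positive scale, which holds on the axis line only near the base point.\<close>
  have "((\<lambda>t. ?c t $ 2) \<longlongrightarrow> ?c 0 $ 2) (at 0)"
    by (auto intro!: tendsto_eq_intros)
  moreover have "?c 0 $ 2 > 0" using assms by (simp add: stable_params_int_def)
  ultimately have "\<forall>\<^sub>F t in at 0. ?c t $ 2 > 0"
    by (rule order_tendstoD)
  then have ev: "\<forall>\<^sub>F t in nhds 0. ?c t $ 2 > 0"
    using assms by (auto simp: eventually_at_filter stable_params_int_def elim!: eventually_mono)
  have cf: "stable_cf \<eta> u = exp (- of_real (decay_exp u \<eta>)) * cis (phase u \<eta>)" if "\<eta> $ 2 > 0" for \<eta>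
    using stable_cf_polar[OF assms(2) that] by (simp add: decay_exp_def phase_def)
  have re: "\<forall>\<^sub>F t in nhds 0. Re (stable_cf (?c t) u) = exp (- decay_exp u (?c t)) * cos (phase u (?c t))"
    using ev by eventually_elim (simp add: cf exp_of_real flip: of_real_minus)
  have im: "\<forall>\<^sub>F t in nhds 0. Im (stable_cf (?c t) u) = exp (- decay_exp u (?c t)) * sin (phase u (?c t))"
    using ev by eventually_elim (simp add: cf exp_of_real flip: of_real_minus)
  show "partial_deriv (\<lambda>\<eta>. Re (stable_cf \<eta> u)) j \<theta> = - \<rho> * (cos B * A' + sin B * B')"
  proof (rule partial_deriv_eqI, subst DERIV_cong_ev[OF refl re refl])
    show "((\<lambda>t. exp (- decay_exp u (?c t)) * cos (phase u (?c t))) has_real_derivative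
       - \<rho> * (cos B * A' + sin B * B')) (at 0)"
      by (rule derivative_eq_intros d refl)+ (simp add: \<rho>_def B_def algebra_simps)
  qed
  show "partial_deriv (\<lambda>\<eta>. Im (stable_cf \<eta> u)) j \<theta> = \<rho> * (cos B * B' - sin B * A')"
  proof (rule partial_deriv_eqI, subst DERIV_cong_ev[OF refl im refl])
    show "((\<lambda>t. exp (- decay_exp u (?c t)) * sin (phase u (?c t))) has_real_derivative
       \<rho> * (cos B * B' - sin B * A')) (at 0)"
      by (rule derivative_eq_intros d refl)+ (simp add: \<rho>_def B_def algebra_simps)
  qed
qed

section \<open>Linear independence of the rows\<close>

text \<open>
  The two hypotheses are the coordinates of the vector of the two conclusions after a rotation
  by the phase and a scaling by \<open>exp (- A)\<close>, up to signs.
\<close>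

lemma score_dependency_splits:
  assumes "\<theta> \<in> stable_params_int" "u \<noteq> 0"
    and "(\<Sum>j\<in>UNIV. y j * partial_deriv (\<lambda>\<eta>. Re (stable_cf \<eta> u)) j \<theta>) = 0"
    and "(\<Sum>j\<in>UNIV. y j * partial_deriv (\<lambda>\<eta>. Im (stable_cf \<eta> u)) j \<theta>) = 0"
  shows "(\<Sum>j\<in>UNIV. y j * partial_deriv (decay_exp u) j \<theta>) = 0"
    and "(\<Sum>j\<in>UNIV. y j * partial_deriv (phase u) j \<theta>) = 0"
proof -
  define X where "X = (\<Sum>j\<in>UNIV. y j * partial_deriv (decay_exp u) j \<theta>)"
  define Y where "Y = (\<Sum>j\<in>UNIV. y j * partial_deriv (phase u) j \<theta>)"
  let ?\<rho> = "exp (- decay_exp u \<theta>)" and ?B = "phase u \<theta>"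
  have "0 = - ?\<rho> * (cos ?B * X + sin ?B * Y)"
    unfolding X_def Y_def assms(3)[symmetric] partial_deriv_stable_cf[OF assms(1,2)]
    by (simp add: sum_4 algebra_simps)
  moreover have "0 = ?\<rho> * (cos ?B * Y - sin ?B * X)"
    unfolding X_def Y_def assms(4)[symmetric] partial_deriv_stable_cf[OF assms(1,2)]
    by (simp add: sum_4 algebra_simps)
  ultimately have "cos ?B * X + sin ?B * Y = 0" "cos ?B * Y - sin ?B * X = 0"
    by simp_all
  moreover have "(cos ?B * X + sin ?B * Y)\<^sup>2 + (cos ?B * Y - sin ?B * X)\<^sup>2
      = ((cos ?B)\<^sup>2 + (sin ?B)\<^sup>2) * (X\<^sup>2 + Y\<^sup>2)"
    by algebra
  ultimately have "X\<^sup>2 + Y\<^sup>2 = 0" by (simp del: sum_power2_eq_zero_iff)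
  then show "X = 0" "Y = 0" by auto
qed

lemma stable_score_independent:
  assumes \<theta>: "\<theta> \<in> stable_params_int" and "u \<noteq> 0" "v \<noteq> 0" "\<bar>u\<bar> \<noteq> \<bar>v\<bar>"
    and re: "\<And>w. w \<in> {u, v} \<Longrightarrow> (\<Sum>j\<in>UNIV. y j * partial_deriv (\<lambda>\<eta>. Re (stable_cf \<eta> w)) j \<theta>) = 0"
    and im: "\<And>w. w \<in> {u, v} \<Longrightarrow> (\<Sum>j\<in>UNIV. y j * partial_deriv (\<lambda>\<eta>. Im (stable_cf \<eta> w)) j \<theta>) = 0"
  shows "y j = 0"
proof -
  have pos: "\<theta>$2 > 0" "\<theta>$3 > 0" "\<theta>$3 < 2" using \<theta> by (auto simp: stable_params_int_def)
  have nz: "w \<noteq> 0" if "w \<in> {u, v}" for w using that assms by auto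
  have dec: "y 3 * ln (\<theta>$2 * \<bar>w\<bar>) = - (y 2 * (\<theta>$3 / \<theta>$2))" if w: "w \<in> {u, v}" for w
  proof -
    have "(\<theta>$2 * \<bar>w\<bar>) powr \<theta>$3 * (y 2 * (\<theta>$3 / \<theta>$2) + y 3 * ln (\<theta>$2 * \<bar>w\<bar>)) = 0"
      using score_dependency_splits(1)[OF \<theta> nz[OF w] re[OF w] im[OF w]]
        decay_exp_partials[OF \<theta> nz[OF w], THEN partial_deriv_eqI]
      by (simp add: sum_4 algebra_simps)
    then have "y 2 * (\<theta>$3 / \<theta>$2) + y 3 * ln (\<theta>$2 * \<bar>w\<bar>) = 0"
      using pos nz[OF w] by simp
    then show ?thesis by linarith
  qed
  have "y 3 * (ln (\<theta>$2 * \<bar>u\<bar>) - ln (\<theta>$2 * \<bar>v\<bar>)) = 0"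
  proof -
    have "y 3 * ln (\<theta>$2 * \<bar>u\<bar>) = y 3 * ln (\<theta>$2 * \<bar>v\<bar>)"
      by (metis dec insertI1 insertI2)
    then show ?thesis by (simp only: right_diff_distrib diff_self)
  qed
  then have y3: "y 3 = 0"
    using assms pos by (simp add: ln_mult)
  with dec[of u] pos have y2: "y 2 = 0" by simp
  have ph: "y 1 = y 4 * \<theta>$2 * skew (\<theta>$3) (\<theta>$2 * \<bar>w\<bar>)" if w: "w \<in> {u, v}" for w
  proof -
    have "w * (y 1 - y 4 * \<theta>$2 * skew (\<theta>$3) (\<theta>$2 * \<bar>w\<bar>)) = 0"
      using score_dependency_splits(2)[OF \<theta> nz[OF w] re[OF w] im[OF w]] y2 y3
        phase_partials(1,4)[OF \<theta> nz[OF w], THEN partial_deriv_eqI]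
      by (simp add: sum_4 algebra_simps)
    then show ?thesis using nz[OF w] by simp
  qed
  have "skew (\<theta>$3) (\<theta>$2 * \<bar>u\<bar>) \<noteq> skew (\<theta>$3) (\<theta>$2 * \<bar>v\<bar>)"
    using skew_inj[of "\<theta>$3" "\<theta>$2 * \<bar>u\<bar>" "\<theta>$2 * \<bar>v\<bar>"] pos assms by auto
  moreover have "y 4 * \<theta>$2 * skew (\<theta>$3) (\<theta>$2 * \<bar>u\<bar>) = y 4 * \<theta>$2 * skew (\<theta>$3) (\<theta>$2 * \<bar>v\<bar>)"
    by (metis ph insertI1 insertI2)
  ultimately have y4: "y 4 = 0" using pos by simp
  with ph[of u] have "y 1 = 0" by simp
  with y2 y3 y4 show ?thesis using exhaust_4[of j] by auto
qed

text \<open>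
  The rows of \<open>A\<close> are the images of the standard basis under the transpose, so injectivity of
  the transpose gives all three forms of full row rank.
\<close>

lemma injective_transpose_imp_rows:
  fixes A :: "real ^ 'm ^ 'n"
  assumes "\<And>y. transpose A *v y = 0 \<Longrightarrow> y = 0"
  shows "inj (\<lambda>j. row j A) \<and> independent (rows A) \<and> rank A = CARD('n)"
proof (intro conjI)
  have inj: "inj ((*v) (transpose A))"
    using assms by (simp add: linear_injective_0 matrix_vector_mul_linear)
  have row: "row j A = transpose A *v axis j 1" for j
    by (simp add: matrix_vector_mult_basis)
  show "inj (\<lambda>j. row j A)"
  proof (rule injI)
    fix i j assume "row i A = row j A"
    then have "axis i (1::real) = axis j 1" unfolding row by (rule injD[OF inj])
    then show "i = j" by (simp add: axis_eq_axis)
  qed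
  have "independent ((\<lambda>j. axis j 1 :: real ^ 'n) ` UNIV)"
    by (rule independent_mono[OF independent_Basis]) (auto simp: Basis_vec_def)
  then have "independent ((*v) (transpose A) ` (\<lambda>j. axis j 1) ` UNIV)"
    using inj inj_on_subset
    by (intro linear_independent_injective_image matrix_vector_mul_linear) blast+
  moreover have "rows A = (*v) (transpose A) ` (\<lambda>j. axis j 1) ` UNIV"
    by (auto simp: rows_def row)
  ultimately show "independent (rows A)" by simp
  show "rank A = CARD('n)"
    using inj full_rank_injective[of "transpose A"] by (simp add: rank_transpose)
qed

lemma transpose_gamma_theta_injective:
  fixes u :: "real ^ 'k::finite"
  assumes \<theta>: "\<theta> \<in> stable_params_int" and nz: "\<forall>i. u$i \<noteq> 0"
    and "\<forall>i j. i \<noteq> j \<longrightarrow> \<bar>u$i\<bar> \<noteq> \<bar>u$j\<bar>" and card: "CARD('k) \<ge> 2"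
    and y: "transpose (gamma_theta u \<theta>) *v y = 0"
  shows "y = 0"
proof -
  obtain i j :: 'k where "i \<noteq> j"
    using card card_le_Suc0_iff_eq[of "UNIV :: 'k set"] by auto
  have "(\<Sum>l\<in>UNIV. y$l * partial_deriv (\<lambda>\<eta>. gamma_vec u \<eta> $ c) l \<theta>) = 0" for c
    using arg_cong[OF y, of "\<lambda>z. z $ c"]
    by (simp add: matrix_vector_mult_def transpose_def gamma_theta_def mult.commute)
  from this[of "Inl _"] this[of "Inr _"] have
    "(\<Sum>l\<in>UNIV. y$l * partial_deriv (\<lambda>\<eta>. Re (stable_cf \<eta> (u$m))) l \<theta>) = 0"
    "(\<Sum>l\<in>UNIV. y$l * partial_deriv (\<lambda>\<eta>. Im (stable_cf \<eta> (u$m))) l \<theta>) = 0" for m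
    by (simp_all add: gamma_vec_def)
  then have "y $ l = 0" for l
    using stable_score_independent[OF \<theta>, of "u$i" "u$j" "\<lambda>l. y$l" l] assms \<open>i \<noteq> j\<close> by auto
  then show ?thesis by (simp add: vec_eq_iff)
qed

section \<open>Smoothness of the characteristic function\<close>

definition second_diff :: "(real \<Rightarrow> complex) \<Rightarrow> real \<Rightarrow> real \<Rightarrow> complex" where
  "second_diff f w s = f (w + s) + f (w - s) - 2 * f w"

text \<open>
  In the second difference the constant and linear Taylor terms cancel, so that only two
  second-order remainders are left.
\<close>

lemma second_diff_holomorphic_bigo:
  assumes hol: "F holomorphic_on S" and S: "open S" "of_real w \<in> S"
    and eq: "\<forall>\<^sub>F t in nhds w. f t = F (of_real t)"
  shows "second_diff f w \<in> O[at_right 0](\<lambda>s. of_real (s\<^sup>2))"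
proof -
  obtain r where r: "r > 0" "cball (of_real w) r \<subseteq> S"
    using S open_contains_cball by blast
  have hol': "deriv F holomorphic_on S" "deriv (deriv F) holomorphic_on S"
    using hol S(1) by (auto intro: holomorphic_deriv)
  have "compact (deriv (deriv F) ` cball (of_real w) r)"
    using holomorphic_on_imp_continuous_on[OF hol'(2)] r(2)
    by (intro compact_continuous_image) (auto intro: continuous_on_subset)
  then obtain B where B: "\<And>z. z \<in> cball (of_real w) r \<Longrightarrow> norm (deriv (deriv F) z) \<le> B"
    by (meson bounded_iff compact_imp_bounded imageI)
  have taylor: "norm (F z - (F (of_real w) + deriv F (of_real w) * (z - of_real w)))
      \<le> B * norm (z - of_real w) ^ 2" if z: "z \<in> cball (of_real w) r" for z
  proof -
    define D where "D i = (if i = 0 then F else if i = 1 then deriv F else deriv (deriv F))" for i :: nat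
    have "(D i has_field_derivative D (Suc i) z) (at z within cball (of_real w) r)"
      if "z \<in> cball (of_real w) r" "i \<le> 1" for i z
    proof -
      have "i = 0 \<or> i = 1" using that(2) by linarith
      then have "D i holomorphic_on S" "D (Suc i) = deriv (D i)"
        using hol hol' by (auto simp: D_def)
      then show ?thesis
        using that r(2) S(1) by (metis has_field_derivative_at_within holomorphic_derivI subsetD)
    qed
    then have "norm (D 0 z - (\<Sum>i\<le>1. D i (of_real w) * (z - of_real w) ^ i / fact i))
        \<le> B * norm (z - of_real w) ^ Suc 1 / fact 1"
      by (rule field_Taylor[OF convex_cball]) (use B z r(1) in \<open>simp_all add: D_def\<close>)
    then show ?thesis by (simp add: D_def numeral_2_eq_2)
  qed
  have "((\<lambda>s. w + s) \<longlongrightarrow> w) (at_right 0)" "((\<lambda>s. w - s) \<longlongrightarrow> w) (at_right 0)"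
    by (auto intro!: tendsto_eq_intros)
  note near = this[THEN eventually_compose_filterlim[OF eq]]
  have "\<forall>\<^sub>F s in at_right 0. s \<in> {0<..<r}"
    using r(1) by (rule eventually_at_right_real)
  then have "\<forall>\<^sub>F s in at_right 0. norm (second_diff f w s) \<le> 2 * B * norm (complex_of_real (s\<^sup>2))"
    using near
  proof eventually_elim
    case (elim s)
    define p where "p = F (of_real (w + s)) - (F (of_real w) + deriv F (of_real w) * of_real s)"
    define m where "m = F (of_real (w - s)) - (F (of_real w) - deriv F (of_real w) * of_real s)"
    have "norm p \<le> B * s\<^sup>2" "norm m \<le> B * s\<^sup>2"
      using taylor[of "of_real (w + s)"] taylor[of "of_real (w - s)"] elim(1)
      by (simp_all add: p_def m_def dist_norm)
    moreover have "second_diff f w s = p + m"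
      using elim eventually_nhds_x_imp_x[OF eq] by (simp add: second_diff_def p_def m_def)
    ultimately have "norm (second_diff f w s) \<le> B * s\<^sup>2 + B * s\<^sup>2"
      by (metis add_mono norm_triangle_le)
    then show ?case by (simp add: norm_power)
  qed
  then show ?thesis by (rule bigoI)
qed

lemma stable_cf_0: "stable_cf \<theta> 0 = 1"
  by (simp add: stable_cf_def Let_def)

lemma stable_cf_minus:
  assumes "\<theta>$2 > 0" "u \<noteq> 0"
  shows "stable_cf \<theta> (- u) = cnj (stable_cf \<theta> u)"
  using assms by (simp add: stable_cf_polar cis_cnj exp_cnj)

text \<open>
  On the positive half-line \<open>\<phi>\<close> is the restriction of a function that is holomorphic on the right
  half-plane; the negative half-line follows by conjugation.
\<close>

lemma stable_cf_second_diff_away_from_0: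
  assumes \<sigma>: "\<theta>$2 > 0" and "w \<noteq> 0"
  shows "second_diff (stable_cf \<theta>) w \<in> O[at_right 0](\<lambda>s. of_real (s\<^sup>2))"
proof -
  have pos: "second_diff (stable_cf \<theta>) w \<in> O[at_right 0](\<lambda>s. of_real (s\<^sup>2))" if "w > 0" for w
  proof (rule second_diff_holomorphic_bigo)
    define S :: "complex \<Rightarrow> complex" where
      "S z = (if \<theta>$3 = 1 then of_real (2 / pi) * Ln z
        else of_real (tan (pi * \<theta>$3 / 2)) * (1 - z powr of_real (\<theta>$3 - 1)))" for z
    define F :: "complex \<Rightarrow> complex" where
      "F z = exp (- ((of_real (\<theta>$2) * z) powr of_real (\<theta>$3))) * exp (\<i> * (of_real (\<theta>$1) * z
          - of_real (\<theta>$4) * (of_real (\<theta>$2) * z) * S (of_real (\<theta>$2) * z)))" for z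
    have S: "S holomorphic_on {z. Re z > 0}"
      unfolding S_def
      by (cases "\<theta>$3 = 1") (auto intro!: holomorphic_intros simp: complex_nonpos_Reals_iff)
    have "S o (\<lambda>z. of_real (\<theta>$2) * z) holomorphic_on {z. Re z > 0}"
      by (rule holomorphic_on_compose_gen[OF _ S]) (use \<sigma> in \<open>auto intro!: holomorphic_intros\<close>)
    then show "F holomorphic_on {z. Re z > 0}"
      unfolding F_def o_def using \<sigma>
      by (auto intro!: holomorphic_intros simp: complex_nonpos_Reals_iff mult_le_0_iff)
    show "open {z. Re z > 0}" by (rule open_halfspace_Re_gt)
    show "of_real w \<in> {z. Re z > 0}" using \<open>w > 0\<close> by simp
    have "\<forall>\<^sub>F t in nhds w. t > 0"
      using eventually_nhds_in_open[of "{0<..}" w] \<open>w > 0\<close> by simp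
    then show "\<forall>\<^sub>F t in nhds w. stable_cf \<theta> t = F (of_real t)"
    proof eventually_elim
      case (elim t)
      have r: "\<theta>$2 * t > 0" using elim \<sigma> by simp
      have pow: "complex_of_real (\<theta>$2 * t) powr of_real a = of_real ((\<theta>$2 * t) powr a)" for a
        using r by (intro powr_of_real) simp
      have "S (of_real (\<theta>$2 * t)) = of_real (skew (\<theta>$3) (\<theta>$2 * t))"
        unfolding S_def skew_def pow Ln_of_real[OF r] by simp
      with pow[of "\<theta>$3"] have "F (of_real t) = exp (- of_real ((\<theta>$2 * t) powr \<theta>$3)) *
          exp (\<i> * of_real (\<theta>$1 * t - \<theta>$4 * (\<theta>$2 * t) * skew (\<theta>$3) (\<theta>$2 * t)))"
        unfolding F_def by simp
      then show ?case
        using elim \<sigma> by (simp add: stable_cf_polar cis_conv_exp)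
    qed
  qed
  show ?thesis
  proof (cases "w > 0")
    case False
    have "\<forall>\<^sub>F s in at_right 0. s \<in> {0<..<- w}"
      using False assms by (intro eventually_at_right_real) auto
    then have "\<forall>\<^sub>F s in at_right 0. second_diff (stable_cf \<theta>) w s = cnj (second_diff (stable_cf \<theta>) (- w) s)"
    proof eventually_elim
      case (elim s)
      then show ?case
        using stable_cf_minus[OF \<sigma>, of "w + s"] stable_cf_minus[OF \<sigma>, of "w - s"]
          stable_cf_minus[OF \<sigma>, of w] assms by (simp add: second_diff_def)
    qed
    then have "second_diff (stable_cf \<theta>) w \<in> O[at_right 0](\<lambda>s. of_real (s\<^sup>2)) \<longleftrightarrow>
      (\<lambda>s. cnj (second_diff (stable_cf \<theta>) (- w) s)) \<in> O[at_right 0](\<lambda>s. of_real (s\<^sup>2))"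
      by (rule landau_o.big.in_cong)
    also have "\<dots> \<longleftrightarrow> second_diff (stable_cf \<theta>) (- w) \<in> O[at_right 0](\<lambda>s. of_real (s\<^sup>2))"
      by (simp add: bigo_def)
    finally show ?thesis using pos[of "- w"] False assms by simp
  qed (use pos in auto)
qed

text \<open>
  The bound \<open>a < 2\<close> on the stability index enters here: the modulus of the characteristic
  function leaves its value \<open>1\<close> at the origin like \<open>\<bar>s\<bar> powr a\<close>, which no quadratic bound allows.
\<close>

lemma square_over_decay_tendsto_0:
  fixes a \<sigma> :: real
  assumes "a > 0" "a < 2" "\<sigma> > 0"
  shows "((\<lambda>s. s\<^sup>2 / (1 - exp (- ((\<sigma> * s) powr a)))) \<longlongrightarrow> 0) (at_right 0)"
  using assms by real_asymp

text \<open>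
  At the origin the second difference is \<open>2 * (Re (\<phi> s) - 1)\<close>, and \<open>Re (\<phi> s)\<close> is at most
  \<open>exp (- ((\<sigma> * s) powr \<alpha>))\<close> whatever the phase is.
\<close>

lemma stable_cf_second_diff_at_0:
  assumes "\<theta> \<in> stable_params_int"
  shows "second_diff (stable_cf \<theta>) 0 \<notin> O[at_right 0](\<lambda>s. of_real (s\<^sup>2))"
proof
  assume "second_diff (stable_cf \<theta>) 0 \<in> O[at_right 0](\<lambda>s. of_real (s\<^sup>2))"
  then obtain c where c: "c > 0"
    "\<forall>\<^sub>F s in at_right 0. norm (second_diff (stable_cf \<theta>) 0 s) \<le> c * norm (complex_of_real (s\<^sup>2))"
    by (elim landau_o.bigE)
  have pos: "\<theta>$2 > 0" "\<theta>$3 > 0" "\<theta>$3 < 2" using assms by (auto simp: stable_params_int_def)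
  have "\<forall>\<^sub>F s in at_right 0. s\<^sup>2 / (1 - exp (- ((\<theta>$2 * s) powr \<theta>$3))) < 1 / c"
    using order_tendstoD(2)[OF square_over_decay_tendsto_0[OF pos(2,3,1)], of "1 / c"] c(1) by simp
  moreover have "\<forall>\<^sub>F s in at_right (0::real). s > 0"
    by (rule eventually_at_right_less)
  ultimately have "\<forall>\<^sub>F s in at_right (0::real). False"
    using c(2)
  proof eventually_elim
    case (elim s)
    define e where "e = exp (- ((\<theta>$2 * s) powr \<theta>$3))"
    have e: "e < 1" using elim pos by (simp add: e_def)
    have re: "Re (stable_cf \<theta> s) \<le> e"
      using elim pos mult_left_le[OF cos_le_one, of e]
      by (simp add: stable_cf_polar exp_of_real e_def flip: of_real_minus)
    have "2 * (1 - e) \<le> - Re (second_diff (stable_cf \<theta>) 0 s)"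
      using re stable_cf_minus[OF pos(1), of s] elim by (simp add: second_diff_def stable_cf_0)
    also have "\<dots> \<le> c * s\<^sup>2"
      using elim complex_Re_le_cmod[of "- second_diff (stable_cf \<theta>) 0 s"] by (simp add: norm_power)
    also have "s\<^sup>2 / (1 - e) < 1 / c"
      using elim by (simp add: e_def)
    then have "c * s\<^sup>2 < 1 - e"
      using e c(1) by (simp add: field_simps)
    finally show False using e by simp
  qed
  then show False by simp
qed

section \<open>Positive definiteness of the covariance matrix\<close>

text \<open>
  The relation \<open>\<Sum>\<^sub>i c\<^sub>i * \<phi> (t + v\<^sub>i) = 0\<close>, valid for all \<open>t\<close>, survives symmetric second differences
  at \<open>t = - v\<^sub>j\<close>.  There every term except the one with index \<open>j\<close> is taken at a nonzero point
  \<open>v\<^sub>i - v\<^sub>j\<close>, hence is \<open>O(s\<^sup>2)\<close>; the remaining one is not unless \<open>c\<^sub>j = 0\<close>.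
\<close>

lemma (in real_distribution) exp_independent_AE:
  fixes v :: "'i \<Rightarrow> real" and c :: "'i \<Rightarrow> complex"
  assumes smooth: "\<And>w. w \<noteq> 0 \<Longrightarrow> second_diff (char M) w \<in> O[at_right 0](\<lambda>s. of_real (s\<^sup>2))"
    and rough: "second_diff (char M) 0 \<notin> O[at_right 0](\<lambda>s. of_real (s\<^sup>2))"
    and I: "finite I" "inj_on v I" "j \<in> I"
    and AE: "AE x in M. (\<Sum>i\<in>I. c i * iexp (v i * x)) = 0"
  shows "c j = 0"
proof (rule ccontr)
  assume "c j \<noteq> 0"
  have int: "integrable M (\<lambda>x. iexp (t * x))" for t
    by (intro integrable_const_bound[where B = 1]) auto
  have shift: "(\<Sum>i\<in>I. c i * char M (t + v i)) = 0" for t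
  proof -
    have "(\<Sum>i\<in>I. c i * char M (t + v i)) = (CLINT x|M. (\<Sum>i\<in>I. c i * iexp ((t + v i) * x)))"
    proof -
      have "integrable M (\<lambda>x. c i * iexp ((t + v i) * x))" for i
        by (intro integrable_mult_right int)
      then show ?thesis
        by (simp only: char_def integral_mult_right_zero Bochner_Integration.integral_sum)
    qed
    also have "\<dots> = (CLINT x|M. iexp (t * x) * (\<Sum>i\<in>I. c i * iexp (v i * x)))"
      by (simp add: sum_distrib_left distrib_right exp_add algebra_simps)
    also have "\<dots> = 0"
      using AE by (intro integral_eq_zero_AE) auto
    finally show ?thesis .
  qed
  have sd: "(\<Sum>i\<in>I. c i * second_diff (char M) (v i - v j) s) = 0" for s
  proof -
    have "(\<Sum>i\<in>I. c i * second_diff (char M) (v i - v j) s) =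
      (\<Sum>i\<in>I. c i * char M ((s - v j) + v i)) + (\<Sum>i\<in>I. c i * char M ((- s - v j) + v i))
      - 2 * (\<Sum>i\<in>I. c i * char M (- v j + v i))"
      by (simp add: second_diff_def sum_distrib_left algebra_simps flip: sum.distrib sum_subtractf)
    then show ?thesis by (simp only: shift) simp
  qed
  have "(\<lambda>s. \<Sum>i\<in>I - {j}. c i * second_diff (char M) (v i - v j) s) \<in> O[at_right 0](\<lambda>s. of_real (s\<^sup>2))"
  proof (rule big_sum_in_bigo)
    fix i assume "i \<in> I - {j}"
    then have "v i - v j \<noteq> 0" using I by (auto dest: inj_onD)
    then show "(\<lambda>s. c i * second_diff (char M) (v i - v j) s) \<in> O[at_right 0](\<lambda>s. of_real (s\<^sup>2))"
      using smooth by (cases "c i = 0") auto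
  qed
  moreover have "(\<Sum>i\<in>I - {j}. c i * second_diff (char M) (v i - v j) s) = - c j * second_diff (char M) 0 s" for s
    using sd[of s] I by (simp add: sum.remove[of I j] add_eq_0_iff2)
  ultimately show False using rough \<open>c j \<noteq> 0\<close> by simp
qed

text \<open>
  By Euler's formula, \<open>x \<bullet> g - C\<close> is a sum of complex exponentials with the frequencies
  \<open>0\<close>, \<open>u\<^sub>i\<close> and \<open>- u\<^sub>i\<close>.  They are distinct exactly because the \<open>u\<^sub>i\<close> are nonzero
  with distinct absolute values.
\<close>

lemma trig_polynomial_AE_zero:
  fixes u :: "real ^ 'k::finite" and x :: "real ^ ('k + 'k)"
  assumes \<theta>: "\<theta> \<in> stable_params_int" and law: "stable_law \<theta> P"
    and nz: "\<forall>i. u$i \<noteq> 0" and dist: "\<forall>i j. i \<noteq> j \<longrightarrow> \<bar>u$i\<bar> \<noteq> \<bar>u$j\<bar>"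
    and AE: "AE t in P. x \<bullet> trig_vec u t = C"
  shows "x = 0"
proof -
  interpret real_distribution P using law by (simp add: stable_law_def)
  have char: "char P = stable_cf \<theta>" using law by (simp add: stable_law_def)
  \<comment> \<open>\<open>None\<close> stands for the constant term, \<open>Some (Inl i)\<close> for \<open>u\<^sub>i\<close>, \<open>Some (Inr i)\<close> for \<open>- u\<^sub>i\<close>.\<close>
  define v :: "('k + 'k) option \<Rightarrow> real" where
    "v = case_option 0 (case_sum (\<lambda>i. u$i) (\<lambda>i. - u$i))"
  define c :: "('k + 'k) option \<Rightarrow> complex" where
    "c = case_option (- of_real C) (case_sum (\<lambda>i. (x$Inl i - \<i> * x$Inr i) / 2) (\<lambda>i. (x$Inl i + \<i> * x$Inr i) / 2))"
  have opp: "u$i \<noteq> - u$j" "- u$i \<noteq> u$j" for i j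
    using nz dist by (cases "i = j"; fastforce)+
  have same: "u$i = u$j \<longleftrightarrow> i = j" for i j
    using dist by metis
  have "inj v"
  proof (rule injI)
    fix k l assume "v k = v l"
    then show "k = l"
      using nz opp same by (cases k; cases l) (auto simp: v_def split: sum.splits)
  qed
  have plus: "(\<Sum>k\<in>UNIV. f k) = (\<Sum>i\<in>UNIV. f (Inl i)) + (\<Sum>i\<in>UNIV. f (Inr i))"
    for f :: "'k + 'k \<Rightarrow> 'b::comm_monoid_add"
    unfolding UNIV_Plus_UNIV[symmetric] by (subst sum.Plus) simp_all
  have euler: "(x$Inl i - \<i> * x$Inr i) / 2 * iexp (u$i * t) + (x$Inl i + \<i> * x$Inr i) / 2 * iexp (- u$i * t)
      = of_real (x$Inl i * cos (u$i * t) + x$Inr i * sin (u$i * t))" for i t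
    unfolding cis_conv_exp[symmetric] by (simp add: complex_eq_iff flip: add_divide_distrib)
  have "(\<Sum>k\<in>UNIV. c k * iexp (v k * t)) = of_real (x \<bullet> trig_vec u t - C)" for t
  proof -
    have "(\<Sum>k\<in>UNIV. c k * iexp (v k * t)) = - of_real C + (\<Sum>k\<in>UNIV. c (Some k) * iexp (v (Some k) * t))"
      by (simp add: UNIV_option_conv sum.reindex c_def v_def)
    also have "(\<Sum>k\<in>UNIV. c (Some k) * iexp (v (Some k) * t)) =
       (\<Sum>i\<in>UNIV. of_real (x$Inl i * cos (u$i * t) + x$Inr i * sin (u$i * t)))"
      unfolding plus sum.distrib[symmetric] euler[symmetric] by (simp add: c_def v_def)
    also have "\<dots> = of_real (x \<bullet> trig_vec u t)"
      by (simp add: inner_vec_def plus trig_vec_def sum.distrib)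
    finally show ?thesis by simp
  qed
  then have AE': "AE t in P. (\<Sum>k\<in>UNIV. c k * iexp (v k * t)) = 0"
    using AE by simp
  have "\<theta>$2 > 0" using \<theta> by (simp add: stable_params_int_def)
  then have smooth: "second_diff (char P) w \<in> O[at_right 0](\<lambda>s. of_real (s\<^sup>2))" if "w \<noteq> 0" for w
    unfolding char using that by (rule stable_cf_second_diff_away_from_0)
  have rough: "second_diff (char P) 0 \<notin> O[at_right 0](\<lambda>s. of_real (s\<^sup>2))"
    unfolding char using \<theta> by (rule stable_cf_second_diff_at_0)
  have "c k = 0" for k
    using smooth rough finite \<open>inj v\<close> UNIV_I AE' by (rule exp_independent_AE)
  then have "c (Some (Inl i)) = 0" for i by blast
  then have zero: "x$Inl i = 0" "x$Inr i = 0" for i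
    by (simp_all add: c_def complex_eq_iff)
  have "x$k = 0" for k
    using zero by (cases k) simp_all
  then show ?thesis by (simp add: vec_eq_iff)
qed

lemma Sigma_mat_quadratic_form:
  assumes "real_distribution P"
  shows "x \<bullet> (Sigma_mat P u \<theta> *v x) = (\<integral>t. (x \<bullet> (trig_vec u t - gamma_vec u \<theta>))\<^sup>2 \<partial>P)"
    and "integrable P (\<lambda>t. (x \<bullet> (trig_vec u t - gamma_vec u \<theta>))\<^sup>2)"
proof -
  interpret real_distribution P by fact
  let ?d = "\<lambda>c t. trig_vec u t $ c - gamma_vec u \<theta> $ c"
  have trig: "(\<lambda>t. trig_vec u t $ c) \<in> borel_measurable P" "\<bar>trig_vec u t $ c\<bar> \<le> 1" for c t
    by (cases c; simp add: trig_vec_def)+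
  have int: "integrable P (\<lambda>t. ?d c t * ?d e t)" for c e
  proof (rule integrable_const_bound)
    have "\<bar>?d c t\<bar> \<le> 1 + \<bar>gamma_vec u \<theta> $ c\<bar>" for c t
      using trig(2)[of t c] by linarith
    then show "AE t in P. norm (?d c t * ?d e t) \<le> (1 + \<bar>gamma_vec u \<theta> $ c\<bar>) * (1 + \<bar>gamma_vec u \<theta> $ e\<bar>)"
      by (intro AE_I2) (auto simp: abs_mult intro!: mult_mono)
  qed (use trig in measurable)
  have sq: "(x \<bullet> (trig_vec u t - gamma_vec u \<theta>))\<^sup>2 = (\<Sum>c\<in>UNIV. \<Sum>e\<in>UNIV. x$c * x$e * (?d c t * ?d e t))" for t
    by (simp add: inner_vec_def power2_eq_square sum_product mult_ac)
  show "integrable P (\<lambda>t. (x \<bullet> (trig_vec u t - gamma_vec u \<theta>))\<^sup>2)"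
    unfolding sq using int by auto
  have "(\<integral>t. (x \<bullet> (trig_vec u t - gamma_vec u \<theta>))\<^sup>2 \<partial>P)
      = (\<Sum>c\<in>UNIV. \<Sum>e\<in>UNIV. x$c * x$e * (\<integral>t. ?d c t * ?d e t \<partial>P))"
    unfolding sq using int by (subst Bochner_Integration.integral_sum; auto)+
  also have "\<dots> = x \<bullet> (Sigma_mat P u \<theta> *v x)"
    by (simp add: inner_vec_def matrix_vector_mult_def Sigma_mat_def sum_distrib_left mult_ac)
  finally show "x \<bullet> (Sigma_mat P u \<theta> *v x) = (\<integral>t. (x \<bullet> (trig_vec u t - gamma_vec u \<theta>))\<^sup>2 \<partial>P)" ..
qed

theorem lemma2p2:
  fixes \<theta> :: "real ^ 4" and u :: "real ^ 'k::finite"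
  assumes "\<theta> \<in> stable_params_int"
    and "\<forall>i. u$i \<noteq> 0"
    and "\<forall>i j. i \<noteq> j \<longrightarrow> \<bar>u$i\<bar> \<noteq> \<bar>u$j\<bar>"
  shows "(CARD('k) \<ge> 2 \<longrightarrow>
            inj (\<lambda>j. row j (gamma_theta u \<theta>)) \<and> independent (rows (gamma_theta u \<theta>)) \<and>
            rank (gamma_theta u \<theta>) = 4) \<and>
         (\<forall>P. stable_law \<theta> P \<longrightarrow> positive_definite (Sigma_mat P u \<theta>))"
proof (intro conjI[where P = "_ \<longrightarrow> _"] impI allI)
  assume "CARD('k) \<ge> 2"
  then show "inj (\<lambda>j. row j (gamma_theta u \<theta>)) \<and> independent (rows (gamma_theta u \<theta>)) \<and>
      rank (gamma_theta u \<theta>) = 4"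
    using injective_transpose_imp_rows[of "gamma_theta u \<theta>"] transpose_gamma_theta_injective[OF assms]
    by simp
next
  fix P assume law: "stable_law \<theta> P"
  then have P: "real_distribution P" by (simp add: stable_law_def)
  show "positive_definite (Sigma_mat P u \<theta>)"
    unfolding positive_definite_def
  proof (intro conjI allI impI)
    show "transpose (Sigma_mat P u \<theta>) = Sigma_mat P u \<theta>"
      by (simp add: transpose_def Sigma_mat_def mult.commute)
    fix x :: "real ^ ('k + 'k)" assume "x \<noteq> 0"
    show "x \<bullet> (Sigma_mat P u \<theta> *v x) > 0"
    proof (rule ccontr)
      assume "\<not> x \<bullet> (Sigma_mat P u \<theta> *v x) > 0"
      moreover have "(\<integral>t. (x \<bullet> (trig_vec u t - gamma_vec u \<theta>))\<^sup>2 \<partial>P) \<ge> 0"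
        by (rule Bochner_Integration.integral_nonneg) simp
      ultimately have "(\<integral>t. (x \<bullet> (trig_vec u t - gamma_vec u \<theta>))\<^sup>2 \<partial>P) = 0"
        unfolding Sigma_mat_quadratic_form(1)[OF P] by linarith
      then have "AE t in P. (x \<bullet> (trig_vec u t - gamma_vec u \<theta>))\<^sup>2 = 0"
        by (subst (asm) integral_nonneg_eq_0_iff_AE[OF Sigma_mat_quadratic_form(2)[OF P]]) simp_all
      then have "AE t in P. x \<bullet> trig_vec u t = x \<bullet> gamma_vec u \<theta>"
        by (simp add: inner_diff_right)
      then show False
        using trig_polynomial_AE_zero[OF assms(1) law assms(2,3)] \<open>x \<noteq> 0\<close> by blast
    qed
  qed
qed

end
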